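(* Let $R$ and $S$ be rings, $U$ a left $R$-module and $V$ a right $S$-module. Then the pair of assignments $(A,\phi)\mapsto \otimes_{(A,\phi)}$ (from representations to bimaps) and $B\mapsto \mathrm{Adj}(B)$ (from bimaps to representations), denoted $\langle U\otimes_{(-)}V,\mathrm{Adj}(-)\rangle$, is a Galois connection between $(R,S)$-bimaps on $U\times V$ and representations in $\mathrm{End}_R U\times\mathrm{End}_S V$. That is, for every $(R,S)$-bimodule $W$, every $(R,S)$-bimap $B:U\times V\to W$ and every representation $\phi:A\to \mathrm{End}_R U\times \mathrm{End}_S V$ of a ring $A$, $$\otimes_{(A,\phi)}\preceq B\quad\Longleftrightarrow\quad A\phi\subseteq \mathrm{Adj}(B).$$
   Context: Homomorphisms of left $R$-modules are written on the right of their arguments ($u\mu$), homomorphisms of right $S$-modules on the left ($\nu v$). An $(R,S)$-bimap on $U\times V$ is a function $B:U\times V\to W$ into some $(R,S)$-bimodule $W$, written $uBv$, that is additive in each variable and satisfies $(ru)Bv=r(uBv)$ and $uB(vs)=(uBv)s$ for all $r\in R$, $s\in S$, $u\in U$, $v\in V$. The ring structure on $\mathrm{End}_R U\times\mathrm{End}_S V$ is componentwise, with $\mathrm{End}_R U$ acting on the right of $U$ (product $\mu\mu'$ means first $\mu$, then $\mu'$) and $\mathrm{End}_S V$ acting on the left of $V$ (usual composition). A representation of a ring $A$ is a ring homomorphism $\phi:A\to\mathrm{End}_R U\times\mathrm{End}_S V$; it makes $U$ an $(R,A)$-bimodule and $V$ an $(A,S)$-bimodule, and $A\phi$ denotes its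 image. Representations are compared by inclusion of images. $\otimes_{(A,\phi)}:U\times V\to U\otimes_A V$ is the resulting tensor product over $A$, regarded as an $(R,S)$-bimap. For an $(R,S)$-bimap $B:U\times V\to W$, the adjoint ring is $$\mathrm{Adj}(B)=\{(\overleftarrow{\mu},\overrightarrow{\mu})\in\mathrm{End}_R U\times\mathrm{End}_S V: (u\overleftarrow{\mu})Bv=uB(\overrightarrow{\mu}v)\ \forall u\in U, v\in V\},$$ regarded as a representation via the inclusion. For $(R,S)$-bimaps $B:U\times V\to W$ and $C:U\times V\to W'$, write $B\preceq C$ if $C$ factors through $B$, i.e. there is an $(R,S)$-bimodule homomorphism $\pi:W\to W'$ with $uCv=(uBv)\pi$ for all $u\in U$, $v\in V$. *)

theory Defs
  imports "HOL-Algebra.Chinese_Remainder" "HOL-Algebra.Free_Abelian_Groups"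
begin

(* Rings are associative and unital but need not be commutative, so the library locale module
   (over a cring) does not apply.  An abelian group is a ring record of which only carrier,
   \<oplus> and \<zero> are relevant; a scalar action is an explicit function that matters only on carriers. *)

locale left_module = R?: ring R + M?: abelian_group M
  for R :: "('r, 'i) ring_scheme" (structure) and M :: "('m, 'j) ring_scheme" (structure)
    and act :: "'r \<Rightarrow> 'm \<Rightarrow> 'm" +
  assumes act_closed: "\<lbrakk>r \<in> carrier R; x \<in> carrier M\<rbrakk> \<Longrightarrow> act r x \<in> carrier M"
    and act_add_scalar: "\<lbrakk>r \<in> carrier R; r' \<in> carrier R; x \<in> carrier M\<rbrakk>
      \<Longrightarrow> act (r \<oplus>\<^bsub>R\<^esub> r') x = act r x \<oplus>\<^bsub>M\<^esub> act r' x"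
    and act_add: "\<lbrakk>r \<in> carrier R; x \<in> carrier M; y \<in> carrier M\<rbrakk>
      \<Longrightarrow> act r (x \<oplus>\<^bsub>M\<^esub> y) = act r x \<oplus>\<^bsub>M\<^esub> act r y"
    and act_mult: "\<lbrakk>r \<in> carrier R; r' \<in> carrier R; x \<in> carrier M\<rbrakk>
      \<Longrightarrow> act (r \<otimes>\<^bsub>R\<^esub> r') x = act r (act r' x)"
    and act_one: "x \<in> carrier M \<Longrightarrow> act \<one>\<^bsub>R\<^esub> x = x"

locale right_module = S?: ring S + M?: abelian_group M
  for S :: "('s, 'i) ring_scheme" (structure) and M :: "('m, 'j) ring_scheme" (structure)
    and act :: "'m \<Rightarrow> 's \<Rightarrow> 'm" +
  assumes act_closed: "\<lbrakk>x \<in> carrier M; s \<in> carrier S\<rbrakk> \<Longrightarrow> act x s \<in> carrier M"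
    and act_add_scalar: "\<lbrakk>x \<in> carrier M; s \<in> carrier S; s' \<in> carrier S\<rbrakk>
      \<Longrightarrow> act x (s \<oplus>\<^bsub>S\<^esub> s') = act x s \<oplus>\<^bsub>M\<^esub> act x s'"
    and act_add: "\<lbrakk>x \<in> carrier M; y \<in> carrier M; s \<in> carrier S\<rbrakk>
      \<Longrightarrow> act (x \<oplus>\<^bsub>M\<^esub> y) s = act x s \<oplus>\<^bsub>M\<^esub> act y s"
    and act_mult: "\<lbrakk>x \<in> carrier M; s \<in> carrier S; s' \<in> carrier S\<rbrakk>
      \<Longrightarrow> act x (s \<otimes>\<^bsub>S\<^esub> s') = act (act x s) s'"
    and act_one: "x \<in> carrier M \<Longrightarrow> act x \<one>\<^bsub>S\<^esub> = x"

record ('r, 's, 'm) bimodule = "'m ring" +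
  lsmult :: "'r \<Rightarrow> 'm \<Rightarrow> 'm"
  rsmult :: "'m \<Rightarrow> 's \<Rightarrow> 'm"

definition is_bimodule :: "'r ring \<Rightarrow> 's ring \<Rightarrow> ('r, 's, 'm) bimodule \<Rightarrow> bool"
  where "is_bimodule R S M \<longleftrightarrow>
    left_module R M (lsmult M) \<and> right_module S M (rsmult M) \<and>
    (\<forall>r \<in> carrier R. \<forall>x \<in> carrier M. \<forall>s \<in> carrier S.
      rsmult M (lsmult M r x) s = lsmult M r (rsmult M x s))"

definition bimodule_hom ::
  "'r ring \<Rightarrow> 's ring \<Rightarrow> ('r, 's, 'm) bimodule \<Rightarrow> ('r, 's, 'n) bimodule \<Rightarrow> ('m \<Rightarrow> 'n) set"
  where "bimodule_hom R S M N = {h. h \<in> carrier M \<rightarrow> carrier N \<and>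
    (\<forall>x \<in> carrier M. \<forall>y \<in> carrier M. h (x \<oplus>\<^bsub>M\<^esub> y) = h x \<oplus>\<^bsub>N\<^esub> h y) \<and>
    (\<forall>r \<in> carrier R. \<forall>x \<in> carrier M. h (lsmult M r x) = lsmult N r (h x)) \<and>
    (\<forall>x \<in> carrier M. \<forall>s \<in> carrier S. h (rsmult M x s) = rsmult N (h x) s)}"

(* B is an (R,S)-bimap on U \<times> V with values in the (R,S)-bimodule W. *)
definition bimap ::
  "'r ring \<Rightarrow> 'u ring \<Rightarrow> ('r \<Rightarrow> 'u \<Rightarrow> 'u) \<Rightarrow> 's ring \<Rightarrow> 'v ring \<Rightarrow> ('v \<Rightarrow> 's \<Rightarrow> 'v) \<Rightarrow>
   ('r, 's, 'w) bimodule \<Rightarrow> ('u \<Rightarrow> 'v \<Rightarrow> 'w) \<Rightarrow> bool"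
  where "bimap R U lU S V rV W B \<longleftrightarrow>
    is_bimodule R S W \<and>
    (\<forall>u \<in> carrier U. \<forall>v \<in> carrier V. B u v \<in> carrier W) \<and>
    (\<forall>u \<in> carrier U. \<forall>u' \<in> carrier U. \<forall>v \<in> carrier V.
      B (u \<oplus>\<^bsub>U\<^esub> u') v = B u v \<oplus>\<^bsub>W\<^esub> B u' v) \<and>
    (\<forall>u \<in> carrier U. \<forall>v \<in> carrier V. \<forall>v' \<in> carrier V.
      B u (v \<oplus>\<^bsub>V\<^esub> v') = B u v \<oplus>\<^bsub>W\<^esub> B u v') \<and>
    (\<forall>r \<in> carrier R. \<forall>u \<in> carrier U. \<forall>v \<in> carrier V. B (lU r u) v = lsmult W r (B u v)) \<and>
    (\<forall>u \<in> carrier U. \<forall>v \<in> carrier V. \<forall>s \<in> carrier S. B u (rV v s) = rsmult W (B u v) s)"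

(* bimap_le R U S V W B W' C: the bimap C into W' factors through the bimap B into W,
   i.e. B \<preceq> C. *)
definition bimap_le ::
  "'r ring \<Rightarrow> 'u ring \<Rightarrow> 's ring \<Rightarrow> 'v ring \<Rightarrow>
   ('r, 's, 'w) bimodule \<Rightarrow> ('u \<Rightarrow> 'v \<Rightarrow> 'w) \<Rightarrow>
   ('r, 's, 'x) bimodule \<Rightarrow> ('u \<Rightarrow> 'v \<Rightarrow> 'x) \<Rightarrow> bool"
  where "bimap_le R U S V W B W' C \<longleftrightarrow>
    (\<exists>h \<in> bimodule_hom R S W W'. \<forall>u \<in> carrier U. \<forall>v \<in> carrier V. C u v = h (B u v))"

(* Endomorphisms are taken extensional (undefined off the carrier), so that each one is
   represented by exactly one HOL function.  On a left module they act on the right, so the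
   product of f and g is first f, then g. *)
definition End_left :: "'r ring \<Rightarrow> 'u ring \<Rightarrow> ('r \<Rightarrow> 'u \<Rightarrow> 'u) \<Rightarrow> ('u \<Rightarrow> 'u) ring"
  where "End_left R U lU =
    \<lparr>carrier = {f \<in> carrier U \<rightarrow>\<^sub>E carrier U.
        (\<forall>x \<in> carrier U. \<forall>y \<in> carrier U. f (x \<oplus>\<^bsub>U\<^esub> y) = f x \<oplus>\<^bsub>U\<^esub> f y) \<and>
        (\<forall>r \<in> carrier R. \<forall>x \<in> carrier U. f (lU r x) = lU r (f x))},
     monoid.mult = (\<lambda>f g. compose (carrier U) g f),
     monoid.one = (\<lambda>x \<in> carrier U. x),
     ring.zero = (\<lambda>x \<in> carrier U. \<zero>\<^bsub>U\<^esub>),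
     ring.add = (\<lambda>f g. \<lambda>x \<in> carrier U. f x \<oplus>\<^bsub>U\<^esub> g x)\<rparr>"

definition End_right :: "'s ring \<Rightarrow> 'v ring \<Rightarrow> ('v \<Rightarrow> 's \<Rightarrow> 'v) \<Rightarrow> ('v \<Rightarrow> 'v) ring"
  where "End_right S V rV =
    \<lparr>carrier = {f \<in> carrier V \<rightarrow>\<^sub>E carrier V.
        (\<forall>x \<in> carrier V. \<forall>y \<in> carrier V. f (x \<oplus>\<^bsub>V\<^esub> y) = f x \<oplus>\<^bsub>V\<^esub> f y) \<and>
        (\<forall>x \<in> carrier V. \<forall>s \<in> carrier S. f (rV x s) = rV (f x) s)},
     monoid.mult = (\<lambda>f g. compose (carrier V) f g),
     monoid.one = (\<lambda>x \<in> carrier V. x),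
     ring.zero = (\<lambda>x \<in> carrier V. \<zero>\<^bsub>V\<^esub>),
     ring.add = (\<lambda>f g. \<lambda>x \<in> carrier V. f x \<oplus>\<^bsub>V\<^esub> g x)\<rparr>"

definition End_pair ::
  "'r ring \<Rightarrow> 'u ring \<Rightarrow> ('r \<Rightarrow> 'u \<Rightarrow> 'u) \<Rightarrow> 's ring \<Rightarrow> 'v ring \<Rightarrow> ('v \<Rightarrow> 's \<Rightarrow> 'v) \<Rightarrow>
   (('u \<Rightarrow> 'u) \<times> ('v \<Rightarrow> 'v)) ring"
  where "End_pair R U lU S V rV = RDirProd (End_left R U lU) (End_right S V rV)"

definition representation ::
  "'r ring \<Rightarrow> 'u ring \<Rightarrow> ('r \<Rightarrow> 'u \<Rightarrow> 'u) \<Rightarrow> 's ring \<Rightarrow> 'v ring \<Rightarrow> ('v \<Rightarrow> 's \<Rightarrow> 'v) \<Rightarrow>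
   'a ring \<Rightarrow> ('a \<Rightarrow> ('u \<Rightarrow> 'u) \<times> ('v \<Rightarrow> 'v)) \<Rightarrow> bool"
  where "representation R U lU S V rV A \<phi> \<longleftrightarrow>
    ring A \<and> \<phi> \<in> ring_hom A (End_pair R U lU S V rV)"

definition Adj ::
  "'r ring \<Rightarrow> 'u ring \<Rightarrow> ('r \<Rightarrow> 'u \<Rightarrow> 'u) \<Rightarrow> 's ring \<Rightarrow> 'v ring \<Rightarrow> ('v \<Rightarrow> 's \<Rightarrow> 'v) \<Rightarrow>
   ('u \<Rightarrow> 'v \<Rightarrow> 'w) \<Rightarrow> (('u \<Rightarrow> 'u) \<times> ('v \<Rightarrow> 'v)) set"
  where "Adj R U lU S V rV B = {\<mu> \<in> carrier (End_pair R U lU S V rV).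
    \<forall>u \<in> carrier U. \<forall>v \<in> carrier V. B (fst \<mu> u) v = B u (snd \<mu> v)}"

definition Adj_ring ::
  "'r ring \<Rightarrow> 'u ring \<Rightarrow> ('r \<Rightarrow> 'u \<Rightarrow> 'u) \<Rightarrow> 's ring \<Rightarrow> 'v ring \<Rightarrow> ('v \<Rightarrow> 's \<Rightarrow> 'v) \<Rightarrow>
   ('u \<Rightarrow> 'v \<Rightarrow> 'w) \<Rightarrow> (('u \<Rightarrow> 'u) \<times> ('v \<Rightarrow> 'v)) ring"
  where "Adj_ring R U lU S V rV B =
    (End_pair R U lU S V rV)\<lparr>carrier := Adj R U lU S V rV B\<rparr>"

(* The tensor product over A of an (R,A)-bimodule P and an (A,S)-bimodule Q: the free abelian
   group on the set P \<times> Q modulo the subgroup generated by biadditivity and A-balance. *)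
definition tensor_relations ::
  "'a ring \<Rightarrow> ('r, 'a, 'p) bimodule \<Rightarrow> ('a, 's, 'q) bimodule \<Rightarrow> ('p \<times> 'q \<Rightarrow>\<^sub>0 int) set"
  where "tensor_relations A P Q =
    {frag_of (p \<oplus>\<^bsub>P\<^esub> p', q) - frag_of (p, q) - frag_of (p', q) | p p' q.
       p \<in> carrier P \<and> p' \<in> carrier P \<and> q \<in> carrier Q} \<union>
    {frag_of (p, q \<oplus>\<^bsub>Q\<^esub> q') - frag_of (p, q) - frag_of (p, q') | p q q'.
       p \<in> carrier P \<and> q \<in> carrier Q \<and> q' \<in> carrier Q} \<union>
    {frag_of (rsmult P p a, q) - frag_of (p, lsmult Q a q) | p a q.
       p \<in> carrier P \<and> a \<in> carrier A \<and> q \<in> carrier Q}"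

definition tensor_subgroup ::
  "'a ring \<Rightarrow> ('r, 'a, 'p) bimodule \<Rightarrow> ('a, 's, 'q) bimodule \<Rightarrow> ('p \<times> 'q \<Rightarrow>\<^sub>0 int) set"
  where "tensor_subgroup A P Q =
    generate (free_Abelian_group (carrier P \<times> carrier Q)) (tensor_relations A P Q)"

(* The scalars act on representatives by r(p \<otimes> q) = rp \<otimes> q and (p \<otimes> q)s = p \<otimes> qs, extended
   linearly; adding the subgroup to the image of a coset gives the coset of the image.
   The ring fields mult and one are irrelevant. *)
definition tensor_product ::
  "'a ring \<Rightarrow> ('r, 'a, 'p) bimodule \<Rightarrow> ('a, 's, 'q) bimodule \<Rightarrow>
   ('r, 's, ('p \<times> 'q \<Rightarrow>\<^sub>0 int) set) bimodule"
  where "tensor_product A P Q =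
    (let F = free_Abelian_group (carrier P \<times> carrier Q); N = tensor_subgroup A P Q in
     \<lparr>carrier = carrier (F Mod N),
      monoid.mult = undefined, monoid.one = undefined,
      ring.zero = \<one>\<^bsub>F Mod N\<^esub>,
      ring.add = monoid.mult (F Mod N),
      lsmult = (\<lambda>r X. N <#>\<^bsub>F\<^esub> frag_extend (\<lambda>(p, q). frag_of (lsmult P r p, q)) ` X),
      rsmult = (\<lambda>X s. N <#>\<^bsub>F\<^esub> frag_extend (\<lambda>(p, q). frag_of (p, rsmult Q q s)) ` X)\<rparr>)"

definition pure_tensor ::
  "'a ring \<Rightarrow> ('r, 'a, 'p) bimodule \<Rightarrow> ('a, 's, 'q) bimodule \<Rightarrow>
   'p \<Rightarrow> 'q \<Rightarrow> ('p \<times> 'q \<Rightarrow>\<^sub>0 int) set"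
  where "pure_tensor A P Q p q =
    tensor_subgroup A P Q #>\<^bsub>free_Abelian_group (carrier P \<times> carrier Q)\<^esub> frag_of (p, q)"

(* U as an (R,A)-bimodule and V as an (A,S)-bimodule via a representation \<phi> of A. *)
definition rep_U ::
  "'u ring \<Rightarrow> ('r \<Rightarrow> 'u \<Rightarrow> 'u) \<Rightarrow> ('a \<Rightarrow> ('u \<Rightarrow> 'u) \<times> ('v \<Rightarrow> 'v)) \<Rightarrow> ('r, 'a, 'u) bimodule"
  where "rep_U U lU \<phi> = ring.extend U \<lparr>lsmult = lU, rsmult = (\<lambda>u a. fst (\<phi> a) u)\<rparr>"

definition rep_V ::
  "'v ring \<Rightarrow> ('v \<Rightarrow> 's \<Rightarrow> 'v) \<Rightarrow> ('a \<Rightarrow> ('u \<Rightarrow> 'u) \<times> ('v \<Rightarrow> 'v)) \<Rightarrow> ('a, 's, 'v) bimodule"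
  where "rep_V V rV \<phi> = ring.extend V \<lparr>lsmult = (\<lambda>a v. snd (\<phi> a) v), rsmult = rV\<rparr>"

(* The bimodule U \<otimes>\<^sub>A V and the bimap (u, v) \<mapsto> u \<otimes> v attached to a representation. *)
definition rep_tensor ::
  "'u ring \<Rightarrow> ('r \<Rightarrow> 'u \<Rightarrow> 'u) \<Rightarrow> 'v ring \<Rightarrow> ('v \<Rightarrow> 's \<Rightarrow> 'v) \<Rightarrow>
   'a ring \<Rightarrow> ('a \<Rightarrow> ('u \<Rightarrow> 'u) \<times> ('v \<Rightarrow> 'v)) \<Rightarrow> ('r, 's, ('u \<times> 'v \<Rightarrow>\<^sub>0 int) set) bimodule"
  where "rep_tensor U lU V rV A \<phi> = tensor_product A (rep_U U lU \<phi>) (rep_V V rV \<phi>)"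

definition rep_tensor_map ::
  "'u ring \<Rightarrow> ('r \<Rightarrow> 'u \<Rightarrow> 'u) \<Rightarrow> 'v ring \<Rightarrow> ('v \<Rightarrow> 's \<Rightarrow> 'v) \<Rightarrow>
   'a ring \<Rightarrow> ('a \<Rightarrow> ('u \<Rightarrow> 'u) \<times> ('v \<Rightarrow> 'v)) \<Rightarrow> 'u \<Rightarrow> 'v \<Rightarrow> ('u \<times> 'v \<Rightarrow>\<^sub>0 int) set"
  where "rep_tensor_map U lU V rV A \<phi> = pure_tensor A (rep_U U lU \<phi>) (rep_V V rV \<phi>)"

end

theory Submission
  imports "HOL-Algebra.Subrings" Defs
begin

text \<open>A map \<open>h\<close> with \<open>u B v = h (u \<otimes> v)\<close> forces \<open>B\<close> to satisfy every identity that \<open>\<otimes>\<close> satisfies. In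
  \<open>U \<otimes>\<^sub>A V\<close> one has \<open>u a \<otimes> v = u \<otimes> a v\<close>, and read in \<open>B\<close> this identity says exactly that the pair
  \<open>\<phi> a\<close> lies in \<open>Adj B\<close>. Conversely, when all these pairs lie in \<open>Adj B\<close>, the bimap \<open>B\<close> is
  biadditive and balanced over \<open>A\<close>, so the universal property of the tensor product
  (\<open>tensor_universal\<close>) yields an additive \<open>h\<close> with \<open>h (u \<otimes> v) = u B v\<close>; it commutes with the
  scalars because it does so on pure tensors. This equivalence is the Galois connection.

  It remains to see that both assignments land where they should. That \<open>Adj B\<close> is a ring is
  checked inside the ring of pairs of endomorphisms. That \<open>U \<otimes>\<^sub>A V\<close> is a bimodule rests on
  two facts about the tensor product of bimodules \<open>P\<close> and \<open>Q\<close>: two additive maps that agree on pure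
  tensors are equal (\<open>additive_eq_on_tensor\<close>), and a pair of additive \<open>A\<close>-linear endomorphisms of
  \<open>P\<close> and \<open>Q\<close> induces an endomorphism of the tensor product (\<open>induced_pure\<close>, \<open>induced_hom\<close>). The
  scalar actions are induced maps, and each bimodule identity is an equation between additive maps,
  hence need only be verified on pure tensors, where it follows from
  the axioms for \<open>P\<close> and \<open>Q\<close>.\<close>

section \<open>Additive maps\<close>

lemma additive_zero:
  assumes "abelian_group M" "abelian_group N" "h \<in> hom (add_monoid M) (add_monoid N)"
  shows "h \<zero>\<^bsub>M\<^esub> = \<zero>\<^bsub>N\<^esub>"
  using hom_one[OF assms(3)] abelian_group.a_group[OF assms(1)] abelian_group.a_group[OF assms(2)]
  by simp

lemma additive_minus:
  assumes "abelian_group M" "abelian_group N" "h \<in> hom (add_monoid M) (add_monoid N)"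
    and "x \<in> carrier M"
  shows "h (\<ominus>\<^bsub>M\<^esub> x) = \<ominus>\<^bsub>N\<^esub> h x"
proof -
  interpret group_hom "add_monoid M" "add_monoid N" h
    using assms by (simp add: group_hom_def group_hom_axioms_def abelian_group.a_group)
  show ?thesis
    using hom_inv assms(4) by (simp add: a_inv_def)
qed

lemma additive_sum:
  assumes "abelian_group N"
    and f: "f \<in> hom (add_monoid M) (add_monoid N)" and g: "g \<in> hom (add_monoid M) (add_monoid N)"
  shows "(\<lambda>x. f x \<oplus>\<^bsub>N\<^esub> g x) \<in> hom (add_monoid M) (add_monoid N)"
proof -
  interpret abelian_group N by fact
  have "f x \<in> carrier N" "g x \<in> carrier N" if "x \<in> carrier M" for x
    using f g that by (auto simp: hom_def)
  then show ?thesis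
    using f g by (auto simp: hom_def a_ac)
qed

section \<open>Endomorphism rings and the adjoint ring\<close>

lemma opposite_ring:
  assumes "ring (E :: 'e ring)"
  shows "ring (E\<lparr>monoid.mult := \<lambda>f g. g \<otimes>\<^bsub>E\<^esub> f\<rparr>)" (is "ring ?O")
proof -
  interpret ring E by fact
  have "abelian_group ?O"
    by (rule comm_group_abelian_groupI) (use a_comm_group in simp)
  moreover have "monoid ?O"
    by (rule monoidI) (auto simp: m_assoc)
  ultimately show ?thesis
    by (rule ringI) (auto simp: l_distr r_distr)
qed

text \<open>Stated for a family of additive maps instead of a module action, because a right action with
  its arguments swapped is a left action only of the opposite ring. Additivity of each scalar is what
  closes the maps commuting with the scalars under sums and negatives.\<close>

lemma End_left_ring:
  fixes U :: "'u ring"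
  assumes U: "abelian_group U"
    and closed: "\<And>r x. \<lbrakk>r \<in> carrier R; x \<in> carrier U\<rbrakk> \<Longrightarrow> act r x \<in> carrier U"
    and add: "\<And>r x y. \<lbrakk>r \<in> carrier R; x \<in> carrier U; y \<in> carrier U\<rbrakk>
      \<Longrightarrow> act r (x \<oplus>\<^bsub>U\<^esub> y) = act r x \<oplus>\<^bsub>U\<^esub> act r y"
  shows "ring (End_left R U act)" (is "ring ?E")
proof -
  interpret abelian_group U by fact
  have act_hom: "act r \<in> hom (add_monoid U) (add_monoid U)" if "r \<in> carrier R" for r
    using that closed add by (auto simp: hom_def)
  note act_zero = additive_zero[OF U U act_hom] and act_minus = additive_minus[OF U U act_hom]
  have E: "f \<in> carrier ?E \<longleftrightarrow> f \<in> carrier U \<rightarrow>\<^sub>E carrier U \<and>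
        (\<forall>x \<in> carrier U. \<forall>y \<in> carrier U. f (x \<oplus>\<^bsub>U\<^esub> y) = f x \<oplus>\<^bsub>U\<^esub> f y) \<and>
        (\<forall>r \<in> carrier R. \<forall>x \<in> carrier U. f (act r x) = act r (f x))" for f
    by (simp add: End_left_def)
  have ops: "f \<otimes>\<^bsub>?E\<^esub> g = compose (carrier U) g f" "\<one>\<^bsub>?E\<^esub> = (\<lambda>x\<in>carrier U. x)"
    "\<zero>\<^bsub>?E\<^esub> = (\<lambda>x\<in>carrier U. \<zero>\<^bsub>U\<^esub>)" "f \<oplus>\<^bsub>?E\<^esub> g = (\<lambda>x\<in>carrier U. f x \<oplus>\<^bsub>U\<^esub> g x)" for f g
    by (simp_all add: End_left_def)
  have mem: "f x \<in> carrier U" if "f \<in> carrier ?E" "x \<in> carrier U" for f x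
    using that by (auto simp: E)
  have lin: "f (x \<oplus>\<^bsub>U\<^esub> y) = f x \<oplus>\<^bsub>U\<^esub> f y" if "f \<in> carrier ?E" "x \<in> carrier U" "y \<in> carrier U"
    for f x y
    using that by (auto simp: E)
  have eq: "f = g" if "f \<in> carrier ?E" "g \<in> carrier ?E" "\<And>x. x \<in> carrier U \<Longrightarrow> f x = g x" for f g
    using that by (meson E PiE_ext)
  have plus_closed: "f \<oplus>\<^bsub>?E\<^esub> g \<in> carrier ?E" if "f \<in> carrier ?E" "g \<in> carrier ?E" for f g
    using that closed add unfolding ops
    by (subst E) (auto simp: mem lin a_ac E[THEN iffD1, THEN conjunct2, THEN conjunct2, rule_format])
  have zero_closed: "\<zero>\<^bsub>?E\<^esub> \<in> carrier ?E"
    using closed act_zero unfolding ops by (subst E) auto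
  have mult_closed: "f \<otimes>\<^bsub>?E\<^esub> g \<in> carrier ?E" if "f \<in> carrier ?E" "g \<in> carrier ?E" for f g
    using that closed unfolding ops
    by (subst E)
      (auto simp: mem lin compose_def E[THEN iffD1, THEN conjunct2, THEN conjunct2, rule_format])
  have one_closed: "\<one>\<^bsub>?E\<^esub> \<in> carrier ?E"
    using closed unfolding ops by (subst E) auto
  have neg: "\<exists>g \<in> carrier ?E. g \<oplus>\<^bsub>?E\<^esub> f = \<zero>\<^bsub>?E\<^esub>" if f: "f \<in> carrier ?E" for f
  proof
    let ?g = "\<lambda>x\<in>carrier U. \<ominus>\<^bsub>U\<^esub> f x"
    show g: "?g \<in> carrier ?E"
      using f closed act_minus
      by (subst E)
        (auto simp: mem lin minus_add a_ac E[THEN iffD1, THEN conjunct2, THEN conjunct2, rule_format])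
    show "?g \<oplus>\<^bsub>?E\<^esub> f = \<zero>\<^bsub>?E\<^esub>"
      by (rule eq[OF plus_closed[OF g f] zero_closed]) (use f in \<open>simp add: ops mem l_neg\<close>)
  qed
  have "abelian_group ?E"
  proof (rule abelian_groupI)
    fix f g h assume m: "f \<in> carrier ?E" "g \<in> carrier ?E" "h \<in> carrier ?E"
    show "f \<oplus>\<^bsub>?E\<^esub> g \<oplus>\<^bsub>?E\<^esub> h = f \<oplus>\<^bsub>?E\<^esub> (g \<oplus>\<^bsub>?E\<^esub> h)"
      using m by (intro eq plus_closed) (auto simp: ops mem a_assoc)
  next
    fix f g assume m: "f \<in> carrier ?E" "g \<in> carrier ?E"
    show "f \<oplus>\<^bsub>?E\<^esub> g = g \<oplus>\<^bsub>?E\<^esub> f"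
      using m by (intro eq plus_closed) (auto simp: ops mem a_comm)
  next
    fix f assume m: "f \<in> carrier ?E"
    show "\<zero>\<^bsub>?E\<^esub> \<oplus>\<^bsub>?E\<^esub> f = f"
      using m zero_closed by (intro eq plus_closed) (auto simp: ops mem)
  qed (use plus_closed zero_closed neg in auto)
  moreover have "monoid ?E"
  proof (rule monoidI)
    fix f g h assume m: "f \<in> carrier ?E" "g \<in> carrier ?E" "h \<in> carrier ?E"
    show "f \<otimes>\<^bsub>?E\<^esub> g \<otimes>\<^bsub>?E\<^esub> h = f \<otimes>\<^bsub>?E\<^esub> (g \<otimes>\<^bsub>?E\<^esub> h)"
      using m by (intro eq mult_closed) (auto simp: ops mem compose_def)
  next
    fix f assume m: "f \<in> carrier ?E"
    show "\<one>\<^bsub>?E\<^esub> \<otimes>\<^bsub>?E\<^esub> f = f"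
      using m one_closed by (intro eq mult_closed) (auto simp: ops mem compose_def)
    show "f \<otimes>\<^bsub>?E\<^esub> \<one>\<^bsub>?E\<^esub> = f"
      using m one_closed by (intro eq mult_closed) (auto simp: ops mem compose_def)
  qed (use mult_closed one_closed in auto)
  ultimately show ?thesis
  proof (rule ringI)
    fix f g h assume m: "f \<in> carrier ?E" "g \<in> carrier ?E" "h \<in> carrier ?E"
    show "(f \<oplus>\<^bsub>?E\<^esub> g) \<otimes>\<^bsub>?E\<^esub> h = f \<otimes>\<^bsub>?E\<^esub> h \<oplus>\<^bsub>?E\<^esub> g \<otimes>\<^bsub>?E\<^esub> h"
      using m by (intro eq mult_closed plus_closed) (auto simp: ops mem lin compose_def)
    show "h \<otimes>\<^bsub>?E\<^esub> (f \<oplus>\<^bsub>?E\<^esub> g) = h \<otimes>\<^bsub>?E\<^esub> f \<oplus>\<^bsub>?E\<^esub> h \<otimes>\<^bsub>?E\<^esub> g"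
      using m by (intro eq mult_closed plus_closed) (auto simp: ops mem compose_def)
  qed
qed

text \<open>Swapping the arguments of the right action leaves the set of endomorphisms unchanged;
  only the order of composition differs. The ring axioms therefore need only be checked once.\<close>

lemma End_right_eq_opposite:
  "End_right S V rV = (End_left S V (\<lambda>s x. rV x s))
     \<lparr>monoid.mult := \<lambda>f g. g \<otimes>\<^bsub>End_left S V (\<lambda>s x. rV x s)\<^esub> f\<rparr>"
  by (auto simp: End_right_def End_left_def)

lemma End_pair_ring:
  assumes "left_module R U lU" "right_module S V rV"
  shows "ring (End_pair R U lU S V rV)"
proof -
  interpret U: left_module R U lU by fact
  interpret V: right_module S V rV by fact
  have "ring (End_left R U lU)"
    by (rule End_left_ring) (auto intro: U.act_closed U.act_add U.M.abelian_group_axioms)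
  moreover have "ring (End_right S V rV)"
    unfolding End_right_eq_opposite
    by (intro opposite_ring End_left_ring)
      (auto intro: V.act_closed V.act_add V.M.abelian_group_axioms)
  ultimately show ?thesis
    unfolding End_pair_def by (rule RDirProd_ring)
qed

lemma End_pair_simps:
  shows "carrier (End_pair R U lU S V rV) = carrier (End_left R U lU) \<times> carrier (End_right S V rV)"
    and "\<mu> \<otimes>\<^bsub>End_pair R U lU S V rV\<^esub> \<nu>
      = (compose (carrier U) (fst \<nu>) (fst \<mu>), compose (carrier V) (snd \<mu>) (snd \<nu>))"
    and "\<mu> \<oplus>\<^bsub>End_pair R U lU S V rV\<^esub> \<nu> = (\<lambda>u\<in>carrier U. fst \<mu> u \<oplus>\<^bsub>U\<^esub> fst \<nu> u,
      \<lambda>v\<in>carrier V. snd \<mu> v \<oplus>\<^bsub>V\<^esub> snd \<nu> v)"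
    and "\<one>\<^bsub>End_pair R U lU S V rV\<^esub> = (\<lambda>u\<in>carrier U. u, \<lambda>v\<in>carrier V. v)"
    and "\<zero>\<^bsub>End_pair R U lU S V rV\<^esub> = (\<lambda>u\<in>carrier U. \<zero>\<^bsub>U\<^esub>, \<lambda>v\<in>carrier V. \<zero>\<^bsub>V\<^esub>)"
  by (auto simp: End_pair_def RDirProd_def DirProd_def monoid.defs End_left_def End_right_def
      split: prod.splits)

lemma End_pair_memD:
  assumes "\<mu> \<in> carrier (End_pair R U lU S V rV)"
  shows "u \<in> carrier U \<Longrightarrow> fst \<mu> u \<in> carrier U"
    and "v \<in> carrier V \<Longrightarrow> snd \<mu> v \<in> carrier V"
    and "\<lbrakk>u \<in> carrier U; u' \<in> carrier U\<rbrakk> \<Longrightarrow> fst \<mu> (u \<oplus>\<^bsub>U\<^esub> u') = fst \<mu> u \<oplus>\<^bsub>U\<^esub> fst \<mu> u'"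
    and "\<lbrakk>v \<in> carrier V; v' \<in> carrier V\<rbrakk> \<Longrightarrow> snd \<mu> (v \<oplus>\<^bsub>V\<^esub> v') = snd \<mu> v \<oplus>\<^bsub>V\<^esub> snd \<mu> v'"
    and "\<lbrakk>r \<in> carrier R; u \<in> carrier U\<rbrakk> \<Longrightarrow> fst \<mu> (lU r u) = lU r (fst \<mu> u)"
    and "\<lbrakk>v \<in> carrier V; s \<in> carrier S\<rbrakk> \<Longrightarrow> snd \<mu> (rV v s) = rV (snd \<mu> v) s"
  using assms by (auto simp: End_pair_simps End_left_def End_right_def)

text \<open>The opposite composition orders in the two components are what makes the adjoint pairs
  closed under products: writing \<open>\<mu>\<close> and \<open>\<nu>\<close> for both components of a pair, in
  \<open>B (\<nu> (\<mu> u)) v = B (\<mu> u) (\<nu> v) = B u (\<mu> (\<nu> v))\<close> the first component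
  applies \<open>\<mu>\<close> first and the second component applies it last.\<close>

lemma Adj_ring_representation:
  fixes W :: "('r, 's, 'w) bimodule"
  assumes mods: "left_module R U lU" "right_module S V rV"
    and B: "bimap R U lU S V rV W B"
  shows "representation R U lU S V rV (Adj_ring R U lU S V rV B) (\<lambda>\<mu>. \<mu>)"
proof -
  let ?E = "End_pair R U lU S V rV" and ?J = "Adj R U lU S V rV B"
  interpret U: left_module R U lU by fact
  interpret V: right_module S V rV by fact
  interpret E: ring ?E using mods by (rule End_pair_ring)
  interpret W: left_module R W "lsmult W"
    using B by (simp add: bimap_def is_bimodule_def)
  have B_closed: "B u v \<in> carrier W" if "u \<in> carrier U" "v \<in> carrier V" for u v
    using B that by (simp add: bimap_def)
  have B_add: "B (u \<oplus>\<^bsub>U\<^esub> u') v = B u v \<oplus>\<^bsub>W\<^esub> B u' v" "B u (v \<oplus>\<^bsub>V\<^esub> v') = B u v \<oplus>\<^bsub>W\<^esub> B u v'"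
    if "u \<in> carrier U" "u' \<in> carrier U" "v \<in> carrier V" "v' \<in> carrier V" for u u' v v'
    using B that by (simp_all add: bimap_def)
  have B_zero: "B \<zero>\<^bsub>U\<^esub> v = \<zero>\<^bsub>W\<^esub>" if "v \<in> carrier V" for v
    using that B_closed B_add
    by (intro additive_zero[OF U.M.abelian_group_axioms W.M.abelian_group_axioms])
      (auto simp: hom_def)
  have B_zero': "B u \<zero>\<^bsub>V\<^esub> = \<zero>\<^bsub>W\<^esub>" if "u \<in> carrier U" for u
    using that B_closed B_add
    by (intro additive_zero[OF V.M.abelian_group_axioms W.M.abelian_group_axioms])
      (auto simp: hom_def)
  have J_carrier: "\<mu> \<in> carrier ?E" if "\<mu> \<in> ?J" for \<mu>
    using that by (simp add: Adj_def)
  have J_adj: "B (fst \<mu> u) v = B u (snd \<mu> v)" if "\<mu> \<in> ?J" "u \<in> carrier U" "v \<in> carrier V" for \<mu> u v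
    using that by (simp add: Adj_def)
  note mem = End_pair_memD(1,2)[OF J_carrier]
  have "subring ?J ?E"
  proof (rule E.subringI)
    show "?J \<subseteq> carrier ?E" "\<one>\<^bsub>?E\<^esub> \<in> ?J"
      using J_carrier by (auto simp: Adj_def E.ring_simprules) (simp add: End_pair_simps)
  next
    fix \<mu> assume \<mu>: "\<mu> \<in> ?J"
    let ?\<nu> = "\<ominus>\<^bsub>?E\<^esub> \<mu>"
    have \<nu>: "?\<nu> \<in> carrier ?E" using \<mu> J_carrier by simp
    have sum: "\<mu> \<oplus>\<^bsub>?E\<^esub> ?\<nu> = \<zero>\<^bsub>?E\<^esub>" using \<mu> J_carrier E.r_neg by simp
    have "B (fst ?\<nu> u) v = B u (snd ?\<nu> v)" if uv: "u \<in> carrier U" "v \<in> carrier V" for u v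
    proof -
      \<comment> \<open>Both sides are additive inverses of the same element of \<open>W\<close>.\<close>
      have "fst \<mu> u \<oplus>\<^bsub>U\<^esub> fst ?\<nu> u = \<zero>\<^bsub>U\<^esub>" "snd \<mu> v \<oplus>\<^bsub>V\<^esub> snd ?\<nu> v = \<zero>\<^bsub>V\<^esub>"
        using fun_cong[OF arg_cong[OF sum, of fst], of u] fun_cong[OF arg_cong[OF sum, of snd], of v]
          uv by (simp_all add: End_pair_simps)
      then have "B (fst \<mu> u) v \<oplus>\<^bsub>W\<^esub> B (fst ?\<nu> u) v = \<zero>\<^bsub>W\<^esub>"
        "B u (snd \<mu> v) \<oplus>\<^bsub>W\<^esub> B u (snd ?\<nu> v) = \<zero>\<^bsub>W\<^esub>"
        using uv \<mu> mem End_pair_memD(1,2)[OF \<nu>] B_zero B_zero' by (simp_all flip: B_add)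
      moreover have "y = z" if "x \<oplus>\<^bsub>W\<^esub> y = \<zero>\<^bsub>W\<^esub>" "x \<oplus>\<^bsub>W\<^esub> z = \<zero>\<^bsub>W\<^esub>"
        "x \<in> carrier W" "y \<in> carrier W" "z \<in> carrier W" for x y z
        using that by (metis W.M.r_neg1)
      ultimately show ?thesis
        using uv J_adj[OF \<mu> uv] mem[OF \<mu>] End_pair_memD(1,2)[OF \<nu>] B_closed by simp
    qed
    with \<nu> show "?\<nu> \<in> ?J" by (simp add: Adj_def)
  next
    fix \<mu> \<nu> assume *: "\<mu> \<in> ?J" "\<nu> \<in> ?J"
    then have "\<mu> \<otimes>\<^bsub>?E\<^esub> \<nu> \<in> carrier ?E" "\<mu> \<oplus>\<^bsub>?E\<^esub> \<nu> \<in> carrier ?E"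
      using J_carrier by simp_all
    with * mem[OF *(1)] mem[OF *(2)] show "\<mu> \<otimes>\<^bsub>?E\<^esub> \<nu> \<in> ?J" "\<mu> \<oplus>\<^bsub>?E\<^esub> \<nu> \<in> ?J"
      by (simp_all add: Adj_def[of R U lU S V rV B])
        (simp_all add: End_pair_simps compose_def B_add J_adj)
  qed
  then have "ring (Adj_ring R U lU S V rV B)"
    unfolding Adj_ring_def by (rule E.subring_is_ring)
  then show ?thesis
    using J_carrier by (auto simp: representation_def ring_hom_def Adj_ring_def)
qed

section \<open>Tensor products of bimodules\<close>

lemma hom_comp: "\<lbrakk>f \<in> hom G H; g \<in> hom H K\<rbrakk> \<Longrightarrow> (\<lambda>x. g (f x)) \<in> hom G K"
  by (auto simp: hom_def Pi_iff)

lemma id_hom: "(\<lambda>x. x) \<in> hom G G"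
  by (auto simp: hom_def)

locale tensor_factors =
  fixes R :: "'r ring" and A :: "'a ring" and S :: "'s ring"
    and P :: "('r, 'a, 'p) bimodule" and Q :: "('a, 's, 'q) bimodule"
  assumes P: "is_bimodule R A P" and Q: "is_bimodule A S Q"
begin

sublocale PL: left_module R P "lsmult P" using P by (simp add: is_bimodule_def)
sublocale PR: right_module A P "rsmult P" using P by (simp add: is_bimodule_def)
sublocale QL: left_module A Q "lsmult Q" using Q by (simp add: is_bimodule_def)
sublocale QR: right_module S Q "rsmult Q" using Q by (simp add: is_bimodule_def)

abbreviation "F \<equiv> free_Abelian_group (carrier P \<times> carrier Q)"
abbreviation "N \<equiv> tensor_subgroup A P Q"
abbreviation "T \<equiv> tensor_product A P Q"
abbreviation pure (infixl "\<boxtimes>" 70) where "p \<boxtimes> q \<equiv> pure_tensor A P Q p q"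

sublocale F: comm_group F by (rule abelian_free_Abelian_group)

declare carrier_free_Abelian_group_iff [simp del]

lemma F_closed [simp]:
  "0 \<in> carrier F"
  "x \<in> carrier F \<Longrightarrow> - x \<in> carrier F"
  "\<lbrakk>x \<in> carrier F; y \<in> carrier F\<rbrakk> \<Longrightarrow> x + y \<in> carrier F"
  "\<lbrakk>x \<in> carrier F; y \<in> carrier F\<rbrakk> \<Longrightarrow> x - y \<in> carrier F"
proof -
  show "0 \<in> carrier F" "x \<in> carrier F \<Longrightarrow> - x \<in> carrier F"
    by (simp_all add: carrier_free_Abelian_group_iff)
  show "\<lbrakk>x \<in> carrier F; y \<in> carrier F\<rbrakk> \<Longrightarrow> x + y \<in> carrier F"
    using F.m_closed[of x y] by simp
  show "\<lbrakk>x \<in> carrier F; y \<in> carrier F\<rbrakk> \<Longrightarrow> x - y \<in> carrier F"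
    using keys_diff[of x y] by (auto simp: carrier_free_Abelian_group_iff)
qed

lemma F_inv [simp]: "x \<in> carrier F \<Longrightarrow> inv\<^bsub>F\<^esub> x = - x"
  by (simp add: carrier_free_Abelian_group_iff)

text \<open>The free abelian group is generated from the basis by differences, and its relations are
  written as differences, so homomorphisms out of it are computed in this form.\<close>

lemma free_hom_diff:
  assumes G: "abelian_group G" and k: "k \<in> hom F (add_monoid G)"
    and x: "x \<in> carrier F" and y: "y \<in> carrier F"
  shows "k (x - y) = k x \<ominus>\<^bsub>G\<^esub> k y"
proof -
  interpret G: abelian_group G by fact
  interpret k: group_hom F "add_monoid G" k
    using k by (simp add: group_hom_def group_hom_axioms_def G.a_group)
  have "k (x - y) = k (x \<otimes>\<^bsub>F\<^esub> inv\<^bsub>F\<^esub> y)"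
    using y by simp
  also have "\<dots> = k x \<oplus>\<^bsub>G\<^esub> \<ominus>\<^bsub>G\<^esub> k y"
    using x y k.hom_mult[of x "inv\<^bsub>F\<^esub> y"] k.hom_inv[of y] by (simp add: a_inv_def)
  finally show ?thesis
    by (simp add: G.minus_eq)
qed

lemma relations_subset: "tensor_relations A P Q \<subseteq> carrier F"
  unfolding tensor_relations_def
  by (auto simp: PR.act_closed QL.act_closed)

lemma relation_cases [consumes 1, case_names left right balanced]:
  assumes "n \<in> tensor_relations A P Q"
  obtains p p' q where "n = frag_of (p \<oplus>\<^bsub>P\<^esub> p', q) - frag_of (p, q) - frag_of (p', q)"
      "p \<in> carrier P" "p' \<in> carrier P" "q \<in> carrier Q"
    | p q q' where "n = frag_of (p, q \<oplus>\<^bsub>Q\<^esub> q') - frag_of (p, q) - frag_of (p, q')"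
      "p \<in> carrier P" "q \<in> carrier Q" "q' \<in> carrier Q"
    | p a q where "n = frag_of (rsmult P p a, q) - frag_of (p, lsmult Q a q)"
      "p \<in> carrier P" "a \<in> carrier A" "q \<in> carrier Q"
  using assms unfolding tensor_relations_def by blast

lemma N_subgroup: "subgroup N F"
  unfolding tensor_subgroup_def by (rule F.generate_is_subgroup) (rule relations_subset)

sublocale N: normal N F
  using N_subgroup by (simp add: F.normal_iff_subgroup)

lemma coset_eqI:
  assumes "x \<in> carrier F" "y \<in> carrier F" "x - y \<in> N"
  shows "N #>\<^bsub>F\<^esub> x = N #>\<^bsub>F\<^esub> y"
proof -
  have "x \<in> N #>\<^bsub>F\<^esub> y"
    using assms(3) by (force simp: r_coset_def)
  then show ?thesis
    using F.repr_independence N_subgroup assms(2) by metis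
qed

text \<open>The additive part of the tensor product has the operations of the quotient group without
  being the same record, so group-theoretic facts are transferred along these equations.\<close>

lemma tensor_quotient:
  "carrier T = carrier (F Mod N)" "X \<oplus>\<^bsub>T\<^esub> Y = X \<otimes>\<^bsub>F Mod N\<^esub> Y" "\<zero>\<^bsub>T\<^esub> = \<one>\<^bsub>F Mod N\<^esub>"
  by (simp_all add: tensor_product_def Let_def)

lemma tensor_homs: "hom G (add_monoid T) = hom G (F Mod N)" "hom (add_monoid T) G = hom (F Mod N) G"
  by (simp_all add: hom_def tensor_quotient)

lemma tensor_abelian_group: "abelian_group T"
proof -
  interpret FN: comm_group "F Mod N" by (rule F.abelian_FactGroup[OF N_subgroup])
  show ?thesis
    by (rule abelian_groupI)
      (unfold tensor_quotient, auto simp: FN.m_ac intro: FN.l_inv_ex simp del: mult_FactGroup one_FactGroup)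
qed

sublocale T: abelian_group T by (rule tensor_abelian_group)

lemma tensor_carrier: "carrier T = (\<lambda>x. N #>\<^bsub>F\<^esub> x) ` carrier F"
  by (simp add: tensor_product_def Let_def carrier_FactGroup)

lemma tensor_add_cosets:
  assumes "x \<in> carrier F" "y \<in> carrier F"
  shows "(N #>\<^bsub>F\<^esub> x) \<oplus>\<^bsub>T\<^esub> (N #>\<^bsub>F\<^esub> y) = N #>\<^bsub>F\<^esub> (x + y)"
  using N.rcos_sum[OF assms] by (simp add: tensor_product_def Let_def)

lemma coset_hom: "(\<lambda>x. N #>\<^bsub>F\<^esub> x) \<in> hom F (add_monoid T)"
  unfolding tensor_homs by (rule N.r_coset_hom_Mod)

lemma pure_closed: "\<lbrakk>p \<in> carrier P; q \<in> carrier Q\<rbrakk> \<Longrightarrow> p \<boxtimes> q \<in> carrier T"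
  unfolding tensor_carrier pure_tensor_def by auto

subsection \<open>The relations between pure tensors\<close>

lemma pure_add_left:
  assumes "p \<in> carrier P" "p' \<in> carrier P" "q \<in> carrier Q"
  shows "(p \<oplus>\<^bsub>P\<^esub> p') \<boxtimes> q = p \<boxtimes> q \<oplus>\<^bsub>T\<^esub> p' \<boxtimes> q"
proof -
  have "frag_of (p \<oplus>\<^bsub>P\<^esub> p', q) - frag_of (p, q) - frag_of (p', q) \<in> N"
    unfolding tensor_subgroup_def using assms
    by (intro generate.incl) (auto simp: tensor_relations_def)
  then have "N #>\<^bsub>F\<^esub> frag_of (p \<oplus>\<^bsub>P\<^esub> p', q) = N #>\<^bsub>F\<^esub> (frag_of (p, q) + frag_of (p', q))"
    using assms by (intro coset_eqI) (auto simp: diff_diff_eq)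
  then show ?thesis
    using assms by (simp add: pure_tensor_def tensor_add_cosets)
qed

lemma pure_add_right:
  assumes "p \<in> carrier P" "q \<in> carrier Q" "q' \<in> carrier Q"
  shows "p \<boxtimes> (q \<oplus>\<^bsub>Q\<^esub> q') = p \<boxtimes> q \<oplus>\<^bsub>T\<^esub> p \<boxtimes> q'"
proof -
  have "frag_of (p, q \<oplus>\<^bsub>Q\<^esub> q') - frag_of (p, q) - frag_of (p, q') \<in> N"
    unfolding tensor_subgroup_def using assms
    by (intro generate.incl) (auto simp: tensor_relations_def)
  then have "N #>\<^bsub>F\<^esub> frag_of (p, q \<oplus>\<^bsub>Q\<^esub> q') = N #>\<^bsub>F\<^esub> (frag_of (p, q) + frag_of (p, q'))"
    using assms by (intro coset_eqI) (auto simp: diff_diff_eq)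
  then show ?thesis
    using assms by (simp add: pure_tensor_def tensor_add_cosets)
qed

lemma pure_balanced:
  assumes "p \<in> carrier P" "a \<in> carrier A" "q \<in> carrier Q"
  shows "rsmult P p a \<boxtimes> q = p \<boxtimes> lsmult Q a q"
  unfolding pure_tensor_def
proof (rule coset_eqI)
  show "frag_of (rsmult P p a, q) - frag_of (p, lsmult Q a q) \<in> N"
    unfolding tensor_subgroup_def using assms
    by (intro generate.incl) (auto simp: tensor_relations_def)
qed (use assms PR.act_closed QL.act_closed in auto)

subsection \<open>Maps out of the tensor product\<close>

text \<open>The cosets of basis elements are the pure tensors, so composing with the quotient map turns
  both maps into homomorphisms on the free group that agree on its basis.\<close>

lemma additive_eq_on_tensor:
  assumes G: "abelian_group G"
    and h: "h \<in> hom (add_monoid T) (add_monoid G)" and k: "k \<in> hom (add_monoid T) (add_monoid G)"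
    and pure: "\<And>p q. \<lbrakk>p \<in> carrier P; q \<in> carrier Q\<rbrakk> \<Longrightarrow> h (p \<boxtimes> q) = k (p \<boxtimes> q)"
    and X: "X \<in> carrier T"
  shows "h X = k X"
proof -
  interpret G: abelian_group G by fact
  let ?c = "\<lambda>x. N #>\<^bsub>F\<^esub> x"
  have h': "(\<lambda>x. h (?c x)) \<in> hom F (add_monoid G)" and k': "(\<lambda>x. k (?c x)) \<in> hom F (add_monoid G)"
    using hom_comp[OF coset_hom] h k by blast+
  have "h (?c x) = k (?c x)" if "x \<in> carrier F" for x
  proof (rule free_Abelian_group_induct[of x "carrier P \<times> carrier Q"])
    show "Poly_Mapping.keys x \<subseteq> carrier P \<times> carrier Q"
      using that by (simp add: carrier_free_Abelian_group_iff)
    show "h (?c 0) = k (?c 0)"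
      using hom_one[OF h' F.is_group G.a_group] hom_one[OF k' F.is_group G.a_group] by simp
    show "h (?c (y - z)) = k (?c (y - z))"
      if "Poly_Mapping.keys y \<subseteq> carrier P \<times> carrier Q" "Poly_Mapping.keys z \<subseteq> carrier P \<times> carrier Q"
        and "h (?c y) = k (?c y)" "h (?c z) = k (?c z)" for y z
      using that free_hom_diff[OF G h'] free_hom_diff[OF G k'] by (simp add: carrier_free_Abelian_group_iff)
    show "h (?c (frag_of a)) = k (?c (frag_of a))" if "a \<in> carrier P \<times> carrier Q" for a
      using that pure by (auto simp: pure_tensor_def)
  qed
  then show ?thesis
    using X unfolding tensor_carrier by blast
qed

text \<open>Extend \<open>f\<close> from the basis to the free group. Biadditivity and balance of \<open>f\<close> say that
  the three families of defining relations are sent to zero, so the extension is constant on the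
  cosets of the subgroup that they generate.\<close>

lemma tensor_universal:
  assumes G: "abelian_group G"
    and closed: "\<And>p q. \<lbrakk>p \<in> carrier P; q \<in> carrier Q\<rbrakk> \<Longrightarrow> f p q \<in> carrier G"
    and add_left: "\<And>p p' q. \<lbrakk>p \<in> carrier P; p' \<in> carrier P; q \<in> carrier Q\<rbrakk>
      \<Longrightarrow> f (p \<oplus>\<^bsub>P\<^esub> p') q = f p q \<oplus>\<^bsub>G\<^esub> f p' q"
    and add_right: "\<And>p q q'. \<lbrakk>p \<in> carrier P; q \<in> carrier Q; q' \<in> carrier Q\<rbrakk>
      \<Longrightarrow> f p (q \<oplus>\<^bsub>Q\<^esub> q') = f p q \<oplus>\<^bsub>G\<^esub> f p q'"
    and balance: "\<And>p a q. \<lbrakk>p \<in> carrier P; a \<in> carrier A; q \<in> carrier Q\<rbrakk>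
      \<Longrightarrow> f (rsmult P p a) q = f p (lsmult Q a q)"
  obtains h where "h \<in> hom (add_monoid T) (add_monoid G)"
    and "\<And>p q. \<lbrakk>p \<in> carrier P; q \<in> carrier Q\<rbrakk> \<Longrightarrow> h (p \<boxtimes> q) = f p q"
proof -
  interpret G: abelian_group G by fact
  have "(\<lambda>(p, q). f p q) ` (carrier P \<times> carrier Q) \<subseteq> carrier (add_monoid G)"
    using closed by auto
  then obtain k where k: "k \<in> hom F (add_monoid G)"
    and k_of: "\<And>x. x \<in> carrier P \<times> carrier Q \<Longrightarrow> k (frag_of x) = (\<lambda>(p, q). f p q) x"
    using comm_group.free_Abelian_group_universal[OF G.a_comm_group] by metis
  interpret k: group_hom F "add_monoid G" k
    using k by (simp add: group_hom_def group_hom_axioms_def G.a_group)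
  note k_diff = free_hom_diff[OF G k]
  have "tensor_relations A P Q \<subseteq> kernel F (add_monoid G) k"
  proof
    fix n assume n: "n \<in> tensor_relations A P Q"
    from n have "k n = \<zero>\<^bsub>G\<^esub>"
    proof (cases rule: relation_cases)
      case left
      then show ?thesis
        by (simp add: k_diff k_of closed add_left G.minus_eq G.a_ac G.r_neg G.r_neg1 G.r_neg2)
    next
      case right
      then show ?thesis
        by (simp add: k_diff k_of closed add_right G.minus_eq G.a_ac G.r_neg G.r_neg1 G.r_neg2)
    next
      case balanced
      then show ?thesis
        by (simp add: k_diff k_of closed balance PR.act_closed QL.act_closed G.minus_eq G.r_neg)
    qed
    with n show "n \<in> kernel F (add_monoid G) k"
      using relations_subset unfolding kernel_def by auto
  qed
  then have N_ker: "N \<subseteq> kernel F (add_monoid G) k"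
    unfolding tensor_subgroup_def by (rule F.generate_subgroup_incl) (rule k.subgroup_kernel)
  have "k x = k y" if x: "x \<in> carrier F" and y: "y \<in> carrier F"
    and eq: "N #>\<^bsub>F\<^esub> x = N #>\<^bsub>F\<^esub> y" for x y
  proof -
    obtain n where n: "n \<in> N" "x = n \<otimes>\<^bsub>F\<^esub> y"
      using F.rcos_self[OF x N_subgroup] eq unfolding r_coset_def by blast
    then have "k n = \<zero>\<^bsub>G\<^esub>" "n \<in> carrier F"
      using N_ker N.subset by (auto simp: kernel_def)
    then show ?thesis
      using k.hom_mult[of n y] y k.hom_closed[of y] unfolding n(2) by simp
  qed
  then obtain h where h: "h \<in> hom (F Mod N) (add_monoid G)"
    and h_coset: "\<And>x. x \<in> carrier F \<Longrightarrow> h (N #>\<^bsub>F\<^esub> x) = k x"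
    using FactGroup_universal[OF k N.normal_axioms] by metis
  show thesis
  proof
    show "h \<in> hom (add_monoid T) (add_monoid G)"
      using h by (simp only: tensor_homs)
  qed (simp add: pure_tensor_def h_coset k_of)
qed

subsection \<open>Functoriality\<close>

text \<open>This is \<open>f \<otimes> g\<close>, written in the shape that the scalar actions of the tensor product have.
  The image of a coset under the linear extension need not be a full coset; adding the
  subgroup of relations completes it.\<close>

definition induced :: "('p \<Rightarrow> 'p) \<Rightarrow> ('q \<Rightarrow> 'q) \<Rightarrow> ('p \<times> 'q \<Rightarrow>\<^sub>0 int) set \<Rightarrow> ('p \<times> 'q \<Rightarrow>\<^sub>0 int) set"
  where "induced f g X = N <#>\<^bsub>F\<^esub> frag_extend (\<lambda>(p, q). frag_of (f p, g q)) ` X"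

definition A_linear :: "('p \<Rightarrow> 'p) \<Rightarrow> ('q \<Rightarrow> 'q) \<Rightarrow> bool"
  where "A_linear f g \<longleftrightarrow>
    f \<in> hom (add_monoid P) (add_monoid P) \<and> g \<in> hom (add_monoid Q) (add_monoid Q) \<and>
    (\<forall>p \<in> carrier P. \<forall>a \<in> carrier A. f (rsmult P p a) = rsmult P (f p) a) \<and>
    (\<forall>a \<in> carrier A. \<forall>q \<in> carrier Q. g (lsmult Q a q) = lsmult Q a (g q))"

text \<open>The linear extension of \<open>(p, q) \<mapsto> (f p, g q)\<close> carries each defining relation to one of the
  same kind, hence preserves the subgroup \<open>N\<close>, and so the image of the coset of \<open>x\<close> lies in the coset of
  the image of \<open>x\<close>.\<close>

lemma induced_coset:
  assumes fg: "A_linear f g" and x: "x \<in> carrier F"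
  defines "t \<equiv> frag_extend (\<lambda>(p, q). frag_of (f p, g q))"
  shows "t x \<in> carrier F" and "induced f g (N #>\<^bsub>F\<^esub> x) = N #>\<^bsub>F\<^esub> t x"
proof -
  have f: "f p \<in> carrier P" if "p \<in> carrier P" for p
    using fg that by (auto simp: A_linear_def hom_def)
  have g: "g q \<in> carrier Q" if "q \<in> carrier Q" for q
    using fg that by (auto simp: A_linear_def hom_def)
  have t_closed: "t y \<in> carrier F" if "y \<in> carrier F" for y
  proof -
    have "Poly_Mapping.keys (t y) \<subseteq>
        (\<Union>z \<in> Poly_Mapping.keys y. Poly_Mapping.keys ((\<lambda>(p, q). frag_of (f p, g q)) z))"
      unfolding t_def by (rule keys_frag_extend)
    also have "\<dots> \<subseteq> carrier P \<times> carrier Q"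
      using that f g by (auto simp: carrier_free_Abelian_group_iff subset_iff)
    finally show ?thesis
      by (simp add: carrier_free_Abelian_group_iff)
  qed
  then show "t x \<in> carrier F" using x .
  have t_of: "t (frag_of (p, q)) = frag_of (f p, g q)" for p q
    by (simp add: t_def)
  have t_relation: "t n \<in> tensor_relations A P Q" if "n \<in> tensor_relations A P Q" for n
  proof -
    have t_diff: "t (y - z) = t y - t z" for y z
      by (simp add: t_def frag_extend_diff)
    have f_add: "f (p \<oplus>\<^bsub>P\<^esub> p') = f p \<oplus>\<^bsub>P\<^esub> f p'" if "p \<in> carrier P" "p' \<in> carrier P" for p p'
      using fg that by (simp add: A_linear_def hom_def)
    have g_add: "g (q \<oplus>\<^bsub>Q\<^esub> q') = g q \<oplus>\<^bsub>Q\<^esub> g q'" if "q \<in> carrier Q" "q' \<in> carrier Q" for q q'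
      using fg that by (simp add: A_linear_def hom_def)
    have f_act: "f (rsmult P p a) = rsmult P (f p) a" if "p \<in> carrier P" "a \<in> carrier A" for p a
      using fg that by (simp add: A_linear_def)
    have g_act: "g (lsmult Q a q) = lsmult Q a (g q)" if "q \<in> carrier Q" "a \<in> carrier A" for q a
      using fg that by (simp add: A_linear_def)
    from that show ?thesis
    proof (cases rule: relation_cases)
      case (left p p' q)
      then have "t n = frag_of (f p \<oplus>\<^bsub>P\<^esub> f p', g q) - frag_of (f p, g q) - frag_of (f p', g q)"
        by (simp add: t_diff t_of f_add)
      then show ?thesis
        unfolding tensor_relations_def using left f g by blast
    next
      case (right p q q')
      then have "t n = frag_of (f p, g q \<oplus>\<^bsub>Q\<^esub> g q') - frag_of (f p, g q) - frag_of (f p, g q')"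
        by (simp add: t_diff t_of g_add)
      then show ?thesis
        unfolding tensor_relations_def using right f g by blast
    next
      case (balanced p a q)
      then have "t n = frag_of (rsmult P (f p) a, g q) - frag_of (f p, lsmult Q a (g q))"
        by (simp add: t_diff t_of f_act g_act)
      then show ?thesis
        unfolding tensor_relations_def using balanced f g by blast
    qed
  qed
  have t_N: "t n \<in> N" if "n \<in> N" for n
    using that unfolding tensor_subgroup_def
  proof (induction n rule: generate.induct)
    case one
    show ?case using generate.one[of F] by (simp add: t_def)
  next
    case (incl h)
    then show ?case by (intro generate.incl t_relation)
  next
    case (inv h)
    then have "h \<in> carrier F" using relations_subset by blast
    moreover have "inv\<^bsub>F\<^esub> (t h) \<in> generate F (tensor_relations A P Q)"
      using inv by (intro generate.inv t_relation)
    ultimately show ?case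
      using t_closed[of h] by (simp add: t_def frag_extend_minus)
  next
    case (eng h k)
    then show ?case
      using generate.eng[OF eng.IH] by (simp add: t_def frag_extend_add)
  qed
  show "induced f g (N #>\<^bsub>F\<^esub> x) = N #>\<^bsub>F\<^esub> t x"
  proof (rule subset_antisym; rule subsetI)
    fix z assume "z \<in> induced f g (N #>\<^bsub>F\<^esub> x)"
    then obtain m n where "m \<in> N" "n \<in> N" "z = m + t (n + x)"
      unfolding induced_def t_def set_mult_def r_coset_def by auto
    then have "m + t n \<in> N" "z = (m + t n) + t x"
      using t_N N.m_closed by (auto simp: t_def frag_extend_add)
    then show "z \<in> N #>\<^bsub>F\<^esub> t x"
      unfolding r_coset_def by auto
  next
    fix z assume "z \<in> N #>\<^bsub>F\<^esub> t x"
    then obtain m where "m \<in> N" "z = m + t (0 + x)"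
      unfolding r_coset_def by auto
    moreover have "0 \<in> N" using N.one_closed by simp
    ultimately show "z \<in> induced f g (N #>\<^bsub>F\<^esub> x)"
      unfolding induced_def t_def set_mult_def r_coset_def by force
  qed
qed

lemma induced_pure:
  assumes "A_linear f g" "p \<in> carrier P" "q \<in> carrier Q"
  shows "induced f g (p \<boxtimes> q) = f p \<boxtimes> g q"
  using induced_coset(2)[OF assms(1), of "frag_of (p, q)"] assms(2,3)
  by (simp add: pure_tensor_def)

lemma induced_hom:
  assumes "A_linear f g"
  shows "induced f g \<in> hom (add_monoid T) (add_monoid T)"
proof (rule homI)
  fix X assume "X \<in> carrier (add_monoid T)"
  then obtain x where x: "x \<in> carrier F" "X = N #>\<^bsub>F\<^esub> x"
    by (auto simp only: tensor_carrier partial_object.simps)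
  show "induced f g X \<in> carrier (add_monoid T)"
    using induced_coset[OF assms x(1)] x(2) by (simp only: tensor_carrier partial_object.simps) blast
  fix Y assume "Y \<in> carrier (add_monoid T)"
  then obtain y where y: "y \<in> carrier F" "Y = N #>\<^bsub>F\<^esub> y"
    by (auto simp only: tensor_carrier partial_object.simps)
  have "x + y \<in> carrier F" using F.m_closed[OF x(1) y(1)] by simp
  then show "induced f g (X \<otimes>\<^bsub>add_monoid T\<^esub> Y) = induced f g X \<otimes>\<^bsub>add_monoid T\<^esub> induced f g Y"
    using x y induced_coset[OF assms] by (simp add: tensor_add_cosets frag_extend_add)
qed

text \<open>The two actions on a bimodule commute; this is the \<open>A\<close>-linearity that lets the outer scalars
  act on the tensor product.\<close>

lemma lsmult_linear: "r \<in> carrier R \<Longrightarrow> A_linear (lsmult P r) (\<lambda>q. q)"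
  using P by (auto simp: A_linear_def hom_def PL.act_closed PL.act_add is_bimodule_def)

lemma rsmult_linear: "s \<in> carrier S \<Longrightarrow> A_linear (\<lambda>p. p) (\<lambda>q. rsmult Q q s)"
  using Q by (auto simp: A_linear_def hom_def QR.act_closed QR.act_add is_bimodule_def)

lemma tensor_lsmult: "lsmult T r = induced (lsmult P r) (\<lambda>q. q)"
  by (rule ext) (simp add: tensor_product_def Let_def induced_def)

lemma tensor_rsmult: "(\<lambda>X. rsmult T X s) = induced (\<lambda>p. p) (\<lambda>q. rsmult Q q s)"
  by (rule ext) (simp add: tensor_product_def Let_def induced_def)

lemma lsmult_hom: "r \<in> carrier R \<Longrightarrow> lsmult T r \<in> hom (add_monoid T) (add_monoid T)"
  unfolding tensor_lsmult by (intro induced_hom lsmult_linear)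

lemma rsmult_hom: "s \<in> carrier S \<Longrightarrow> (\<lambda>X. rsmult T X s) \<in> hom (add_monoid T) (add_monoid T)"
  unfolding tensor_rsmult by (intro induced_hom rsmult_linear)

lemma lsmult_pure:
  "\<lbrakk>r \<in> carrier R; p \<in> carrier P; q \<in> carrier Q\<rbrakk> \<Longrightarrow> lsmult T r (p \<boxtimes> q) = lsmult P r p \<boxtimes> q"
  unfolding tensor_lsmult by (simp add: induced_pure lsmult_linear)

lemma rsmult_pure:
  "\<lbrakk>s \<in> carrier S; p \<in> carrier P; q \<in> carrier Q\<rbrakk> \<Longrightarrow> rsmult T (p \<boxtimes> q) s = p \<boxtimes> rsmult Q q s"
  using fun_cong[OF tensor_rsmult, of "p \<boxtimes> q" s] by (simp add: induced_pure rsmult_linear)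

lemmas tensor_eqI = additive_eq_on_tensor[OF tensor_abelian_group]

text \<open>Both sides of each axiom are additive in the tensor, so all but closure and additivity, which
  hold for every induced map, are compared on pure tensors.\<close>

lemma tensor_product_bimodule: "is_bimodule R S T"
  unfolding is_bimodule_def
proof (intro conjI ballI)
  show "left_module R T (lsmult T)"
  proof (intro left_module.intro left_module_axioms.intro)
    show "ring R" "abelian_group T" by unfold_locales
  next
    fix r X Y assume "r \<in> carrier R" "X \<in> carrier T" "Y \<in> carrier T"
    then show "lsmult T r X \<in> carrier T"
      "lsmult T r (X \<oplus>\<^bsub>T\<^esub> Y) = lsmult T r X \<oplus>\<^bsub>T\<^esub> lsmult T r Y"
      using lsmult_hom[of r] by (auto simp: hom_def)
  next
    fix r r' X assume *: "r \<in> carrier R" "r' \<in> carrier R" and X: "X \<in> carrier T"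
    show "lsmult T (r \<oplus>\<^bsub>R\<^esub> r') X = lsmult T r X \<oplus>\<^bsub>T\<^esub> lsmult T r' X"
      by (rule tensor_eqI[OF _ _ _ X])
        (use * in \<open>simp_all add: lsmult_hom additive_sum tensor_abelian_group lsmult_pure
          pure_add_left PL.act_closed PL.act_add_scalar\<close>)
    show "lsmult T (r \<otimes>\<^bsub>R\<^esub> r') X = lsmult T r (lsmult T r' X)"
      by (rule tensor_eqI[OF _ hom_comp[OF lsmult_hom lsmult_hom] _ X])
        (use * in \<open>simp_all add: lsmult_hom lsmult_pure PL.act_closed PL.act_mult\<close>)
  next
    fix X assume X: "X \<in> carrier T"
    show "lsmult T \<one>\<^bsub>R\<^esub> X = X"
      by (rule tensor_eqI[OF _ id_hom _ X])
        (simp_all add: lsmult_hom lsmult_pure PL.act_one)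
  qed
  show "right_module S T (rsmult T)"
  proof (intro right_module.intro right_module_axioms.intro)
    show "ring S" "abelian_group T" by unfold_locales
  next
    fix s X Y assume "s \<in> carrier S" "X \<in> carrier T" "Y \<in> carrier T"
    then show "rsmult T X s \<in> carrier T"
      "rsmult T (X \<oplus>\<^bsub>T\<^esub> Y) s = rsmult T X s \<oplus>\<^bsub>T\<^esub> rsmult T Y s"
      using rsmult_hom[of s] by (auto simp: hom_def)
  next
    fix s s' X assume *: "s \<in> carrier S" "s' \<in> carrier S" and X: "X \<in> carrier T"
    show "rsmult T X (s \<oplus>\<^bsub>S\<^esub> s') = rsmult T X s \<oplus>\<^bsub>T\<^esub> rsmult T X s'"
      by (rule tensor_eqI[where h = "\<lambda>X. rsmult T X (s \<oplus>\<^bsub>S\<^esub> s')", OF _ _ _ X])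
        (use * in \<open>simp_all add: rsmult_hom additive_sum tensor_abelian_group rsmult_pure
          pure_add_right QR.act_closed QR.act_add_scalar\<close>)
    show "rsmult T X (s \<otimes>\<^bsub>S\<^esub> s') = rsmult T (rsmult T X s) s'"
      by (rule tensor_eqI[where h = "\<lambda>X. rsmult T X (s \<otimes>\<^bsub>S\<^esub> s')",
            OF _ hom_comp[OF rsmult_hom rsmult_hom] _ X])
        (use * in \<open>simp_all add: rsmult_hom rsmult_pure QR.act_closed QR.act_mult\<close>)
  next
    fix X assume X: "X \<in> carrier T"
    show "rsmult T X \<one>\<^bsub>S\<^esub> = X"
      by (rule tensor_eqI[OF rsmult_hom id_hom _ X]) (simp_all add: rsmult_pure QR.act_one)
  qed
next
  fix r X s assume *: "r \<in> carrier R" "s \<in> carrier S" and X: "X \<in> carrier T"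
  show "rsmult T (lsmult T r X) s = lsmult T r (rsmult T X s)"
    by (rule tensor_eqI[OF hom_comp[OF lsmult_hom rsmult_hom] hom_comp[OF rsmult_hom lsmult_hom] _ X])
      (use * in \<open>simp_all add: lsmult_pure rsmult_pure PL.act_closed QR.act_closed\<close>)
qed

end

section \<open>The Galois connection\<close>

lemma rep_U_simps:
  "carrier (rep_U U lU \<phi>) = carrier U" "add (rep_U U lU \<phi>) = add U" "\<zero>\<^bsub>rep_U U lU \<phi>\<^esub> = \<zero>\<^bsub>U\<^esub>"
  "lsmult (rep_U U lU \<phi>) = lU" "rsmult (rep_U U lU \<phi>) u a = fst (\<phi> a) u"
  by (simp_all add: rep_U_def ring.defs)

lemma rep_V_simps:
  "carrier (rep_V V rV \<phi>) = carrier V" "add (rep_V V rV \<phi>) = add V" "\<zero>\<^bsub>rep_V V rV \<phi>\<^esub> = \<zero>\<^bsub>V\<^esub>"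
  "lsmult (rep_V V rV \<phi>) a v = snd (\<phi> a) v" "rsmult (rep_V V rV \<phi>) = rV"
  by (simp_all add: rep_V_def ring.defs)

text \<open>Because the product in \<open>End_pair\<close> composes first components in reverse order, multiplicativity
  of \<open>\<phi>\<close> reads \<open>u (a b) = (u a) b\<close> on \<open>U\<close> and \<open>(a b) v = a (b v)\<close> on \<open>V\<close>. The actions of \<open>R\<close> and \<open>A\<close>
  on \<open>U\<close>, and those of \<open>A\<close> and \<open>S\<close> on \<open>V\<close>, commute since \<open>\<phi>\<close> takes values in linear maps.\<close>

lemma representation_bimodules:
  assumes mods: "left_module R U lU" "right_module S V rV"
    and \<phi>: "representation R U lU S V rV A \<phi>"
  shows "is_bimodule R A (rep_U U lU \<phi>)" and "is_bimodule A S (rep_V V rV \<phi>)"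
proof -
  let ?E = "End_pair R U lU S V rV"
  interpret U: left_module R U lU by fact
  interpret V: right_module S V rV by fact
  interpret A: ring A using \<phi> by (simp add: representation_def)
  have hom: "\<phi> \<in> ring_hom A ?E" using \<phi> by (simp add: representation_def)
  note mem = End_pair_memD[OF ring_hom_closed[OF hom]]
  have U_grp: "abelian_group (rep_U U lU \<phi>)"
    by (rule abelian_groupI)
      (auto simp: rep_U_simps U.M.a_ac intro: bexI[of _ "\<ominus>\<^bsub>U\<^esub> _"] U.M.l_neg)
  have V_grp: "abelian_group (rep_V V rV \<phi>)"
    by (rule abelian_groupI)
      (auto simp: rep_V_simps V.M.a_ac intro: bexI[of _ "\<ominus>\<^bsub>V\<^esub> _"] V.M.l_neg)
  show "is_bimodule R A (rep_U U lU \<phi>)"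
    unfolding is_bimodule_def left_module_def left_module_axioms_def right_module_def
      right_module_axioms_def
    using U.R.ring_axioms A.ring_axioms U_grp
    by (auto simp: rep_U_simps mem U.act_closed U.act_add U.act_add_scalar U.act_mult U.act_one
        ring_hom_add[OF hom] ring_hom_mult[OF hom] ring_hom_one[OF hom] End_pair_simps compose_def)
  show "is_bimodule A S (rep_V V rV \<phi>)"
    unfolding is_bimodule_def left_module_def left_module_axioms_def right_module_def
      right_module_axioms_def
    using V.S.ring_axioms A.ring_axioms V_grp
    by (auto simp: rep_V_simps mem V.act_closed V.act_add V.act_add_scalar V.act_mult V.act_one
        ring_hom_add[OF hom] ring_hom_mult[OF hom] ring_hom_one[OF hom] End_pair_simps compose_def)
qed

lemma rep_tensor_bimap:
  assumes mods: "left_module R U lU" "right_module S V rV"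
    and \<phi>: "representation R U lU S V rV A \<phi>"
  shows "bimap R U lU S V rV (rep_tensor U lU V rV A \<phi>) (rep_tensor_map U lU V rV A \<phi>)"
proof -
  interpret tensor_factors R A S "rep_U U lU \<phi>" "rep_V V rV \<phi>"
    using representation_bimodules[OF assms] by (rule tensor_factors.intro)
  show ?thesis
    unfolding bimap_def rep_tensor_def rep_tensor_map_def
    using tensor_product_bimodule pure_closed pure_add_left pure_add_right lsmult_pure rsmult_pure
    by (simp add: rep_U_simps rep_V_simps)
qed

lemma rep_tensor_balanced:
  assumes mods: "left_module R U lU" "right_module S V rV"
    and \<phi>: "representation R U lU S V rV A \<phi>"
    and "u \<in> carrier U" "a \<in> carrier A" "v \<in> carrier V"
  shows "rep_tensor_map U lU V rV A \<phi> (fst (\<phi> a) u) v = rep_tensor_map U lU V rV A \<phi> u (snd (\<phi> a) v)"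
proof -
  interpret tensor_factors R A S "rep_U U lU \<phi>" "rep_V V rV \<phi>"
    using representation_bimodules[OF mods \<phi>] by (rule tensor_factors.intro)
  show ?thesis
    using pure_balanced[of u a v] assms(4-6)
    by (simp add: rep_tensor_map_def rep_U_simps rep_V_simps)
qed

lemma rep_tensor_factors:
  assumes mods: "left_module R U lU" "right_module S V rV"
    and \<phi>: "representation R U lU S V rV A \<phi>" and B: "bimap R U lU S V rV W B"
    and balanced: "\<And>u a v. \<lbrakk>u \<in> carrier U; a \<in> carrier A; v \<in> carrier V\<rbrakk>
      \<Longrightarrow> B (fst (\<phi> a) u) v = B u (snd (\<phi> a) v)"
  shows "bimap_le R U S V (rep_tensor U lU V rV A \<phi>) (rep_tensor_map U lU V rV A \<phi>) W B"
proof -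
  let ?T = "tensor_product A (rep_U U lU \<phi>) (rep_V V rV \<phi>)"
  let ?pure = "pure_tensor A (rep_U U lU \<phi>) (rep_V V rV \<phi>)"
  interpret tensor_factors R A S "rep_U U lU \<phi>" "rep_V V rV \<phi>"
    using representation_bimodules[OF mods \<phi>] by (rule tensor_factors.intro)
  interpret U: left_module R U lU by fact
  interpret V: right_module S V rV by fact
  interpret WL: left_module R W "lsmult W" using B by (simp add: bimap_def is_bimodule_def)
  interpret WR: right_module S W "rsmult W" using B by (simp add: bimap_def is_bimodule_def)
  note W = WL.M.abelian_group_axioms
  obtain h where h: "h \<in> hom (add_monoid ?T) (add_monoid W)"
    and h_pure: "\<And>u v. \<lbrakk>u \<in> carrier U; v \<in> carrier V\<rbrakk> \<Longrightarrow> h (?pure u v) = B u v"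
    by (rule tensor_universal[OF W, of B])
      (use B balanced in \<open>auto simp: bimap_def rep_U_simps rep_V_simps\<close>)
  have W_hom: "lsmult W r \<in> hom (add_monoid W) (add_monoid W)" if "r \<in> carrier R" for r
    using that by (auto simp: hom_def WL.act_closed WL.act_add)
  have W_hom': "(\<lambda>x. rsmult W x s) \<in> hom (add_monoid W) (add_monoid W)" if "s \<in> carrier S" for s
    using that by (auto simp: hom_def WR.act_closed WR.act_add)
  \<comment> \<open>Linearity of an additive map can be tested on pure tensors, where it is that of \<open>B\<close>.\<close>
  have left: "h (lsmult ?T r X) = lsmult W r (h X)" if r: "r \<in> carrier R" and X: "X \<in> carrier ?T" for r X
    by (rule additive_eq_on_tensor[OF W hom_comp[OF lsmult_hom h] hom_comp[OF h W_hom] _ X])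
      (use r B in \<open>simp_all add: rep_U_simps rep_V_simps lsmult_pure h_pure U.act_closed bimap_def\<close>)
  have right: "h (rsmult ?T X s) = rsmult W (h X) s" if s: "s \<in> carrier S" and X: "X \<in> carrier ?T" for s X
    by (rule additive_eq_on_tensor[OF W hom_comp[OF rsmult_hom h] hom_comp[OF h W_hom'] _ X])
      (use s B in \<open>simp_all add: rep_U_simps rep_V_simps rsmult_pure h_pure V.act_closed bimap_def\<close>)
  have "h \<in> bimodule_hom R S ?T W"
    using h left right by (auto simp: bimodule_hom_def hom_def)
  then show ?thesis
    unfolding bimap_le_def rep_tensor_def rep_tensor_map_def
    by (rule bexI[rotated]) (simp add: h_pure)
qed

theorem theorem2p8:
  fixes R :: "'r ring" and S :: "'s ring"
    and U :: "'u ring" and lU :: "'r \<Rightarrow> 'u \<Rightarrow> 'u"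
    and V :: "'v ring" and rV :: "'v \<Rightarrow> 's \<Rightarrow> 'v"
  assumes "ring R" and "ring S"
    and "left_module R U lU" and "right_module S V rV"
  shows "(\<forall>(A :: 'a ring) \<phi>. representation R U lU S V rV A \<phi> \<longrightarrow>
            bimap R U lU S V rV (rep_tensor U lU V rV A \<phi>) (rep_tensor_map U lU V rV A \<phi>)) \<and>
         (\<forall>(W :: ('r, 's, 'w) bimodule) B. bimap R U lU S V rV W B \<longrightarrow>
            representation R U lU S V rV (Adj_ring R U lU S V rV B) (\<lambda>\<mu>. \<mu>)) \<and>
         (\<forall>(W :: ('r, 's, 'w) bimodule) B (A :: 'a ring) \<phi>.
            bimap R U lU S V rV W B \<longrightarrow> representation R U lU S V rV A \<phi> \<longrightarrow>
            (bimap_le R U S V (rep_tensor U lU V rV A \<phi>) (rep_tensor_map U lU V rV A \<phi>) W B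
              \<longleftrightarrow> \<phi> ` carrier A \<subseteq> Adj R U lU S V rV B))"
proof (intro conjI allI impI)
  note mods = assms(3,4)
  fix A :: "'a ring" and \<phi>
  assume \<phi>: "representation R U lU S V rV A \<phi>"
  then show "bimap R U lU S V rV (rep_tensor U lU V rV A \<phi>) (rep_tensor_map U lU V rV A \<phi>)"
    by (rule rep_tensor_bimap[OF mods])
next
  fix W :: "('r, 's, 'w) bimodule" and B
  assume "bimap R U lU S V rV W B"
  then show "representation R U lU S V rV (Adj_ring R U lU S V rV B) (\<lambda>\<mu>. \<mu>)"
    by (rule Adj_ring_representation[OF assms(3,4)])
next
  note mods = assms(3,4)
  fix W :: "('r, 's, 'w) bimodule" and B and A :: "'a ring" and \<phi>
  assume B: "bimap R U lU S V rV W B" and \<phi>: "representation R U lU S V rV A \<phi>"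
  have \<phi>_closed: "\<phi> a \<in> carrier (End_pair R U lU S V rV)" if "a \<in> carrier A" for a
    using \<phi> that by (auto simp: representation_def ring_hom_closed)
  show "bimap_le R U S V (rep_tensor U lU V rV A \<phi>) (rep_tensor_map U lU V rV A \<phi>) W B
    \<longleftrightarrow> \<phi> ` carrier A \<subseteq> Adj R U lU S V rV B" (is "?le \<longleftrightarrow> ?sub")
  proof
    assume ?le
    then obtain h where h: "\<And>u v. \<lbrakk>u \<in> carrier U; v \<in> carrier V\<rbrakk>
        \<Longrightarrow> B u v = h (rep_tensor_map U lU V rV A \<phi> u v)"
      unfolding bimap_le_def by blast
    have "B (fst (\<phi> a) u) v = B u (snd (\<phi> a) v)"
      if "u \<in> carrier U" "a \<in> carrier A" "v \<in> carrier V" for u a v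
      using that End_pair_memD(1,2)[OF \<phi>_closed] rep_tensor_balanced[OF mods \<phi>] by (simp add: h)
    then show ?sub
      using \<phi>_closed by (auto simp: Adj_def)
  next
    assume ?sub
    then show ?le
      by (intro rep_tensor_factors[OF mods \<phi> B]) (auto simp: Adj_def)
  qed
qed

end
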